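(* The bracket $\{\,,\,\}_\Omega$ defines a Poisson structure on $\mathbb C^6$. The Poisson structure $\{\,,\,\}_\Omega$ is invariant under all $\lambda_{i,j}$ and under $\nu$, and is anti-invariant under $\tau_1,\tau_2,\sigma_1,\sigma_2$.
   Context: Consider $\mathbb C^6$ with coordinates $x=(x_1,\dots,x_6)$, volume form $dV=dx_1\wedge dx_2\wedge dx_3\wedge dx_4\wedge dx_5\wedge dx_6$, and the differential 4-form (writing $dx_{ijkl}=dx_i\wedge dx_j\wedge dx_k\wedge dx_l$) $$\begin{aligned}\Omega=\ &x_1x_3\,dx_{2456}+x_1x_4\,dx_{2356}-x_1x_5\,dx_{2346}-x_1x_6\,dx_{2345}\\&+x_2x_3\,dx_{1456}+x_2x_4\,dx_{1356}-x_2x_5\,dx_{1346}-x_2x_6\,dx_{1345}\\&+x_3x_5\,dx_{1246}+x_3x_6\,dx_{1245}+x_4x_5\,dx_{1236}+x_4x_6\,dx_{1235}.\end{aligned}$$ For functions $f_1,f_2$ on $\mathbb C^6$ put $\{f_1,f_2\}_\Omega=\dfrac{\Omega\wedge df_1\wedge df_2}{dV}$. Consider the following maps $\mathbb C^6\to\mathbb C^6$: $\nu:x\mapsto(x_2,x_1,x_4,x_3,x_6,x_5)$; $\lambda_{i,j}:x\mapsto((-1)^ix_1,(-1)^ix_2,(-1)^{i+j}x_3,(-1)^{i+j}x_4,(-1)^jx_5,(-1)^jx_6)$, $i,j\in\mathbb Z/2$; $\sigma_1:x\mapsto(x_3,x_4,x_1,x_2,x_5,x_6)$; $\sigma_2:x\mapsto(x_1,x_2,x_5,x_6,x_3,x_4)$;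 $\tau_1:x\mapsto(-x_2,-x_1,x_6,x_5,x_4-x_1x_5,x_3-x_2x_6)$; $\tau_2:x\mapsto(x_4,x_3,x_2-x_3x_5,x_1-x_4x_6,-x_6,-x_5)$. A bracket is invariant (resp. anti-invariant) under an invertible map $\phi$ if $\{f\circ\phi,g\circ\phi\}=\{f,g\}\circ\phi$ (resp. $=-\{f,g\}\circ\phi$) for all functions $f,g$. *)

theory Defs
  imports "HOL-Analysis.Analysis"
begin

section \<open>The exterior algebra on a finite ordered coordinate system\<close>

text \<open>
  An element of the exterior algebra on the generators \<open>dx_i\<close>, \<open>i :: 'n\<close>, is given by its
  coefficients in the basis \<open>dx_I\<close>, \<open>I \<subseteq> UNIV\<close>, where \<open>dx_I\<close> is the wedge product of the
  \<open>dx_i\<close>, \<open>i \<in> I\<close>, taken in increasing order of \<open>i\<close>.  For \<open>I \<inter> J = {}\<close> one has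
  \<open>dx_I \<and> dx_J = wedge_sign I J * dx_(I \<union> J)\<close>, and \<open>dx_I \<and> dx_J = 0\<close> otherwise.
\<close>

type_synonym 'n form = "complex ^ ('n set)"

definition wedge_sign :: "'n::{finite,linorder} set \<Rightarrow> 'n set \<Rightarrow> complex" where
  "wedge_sign I J = (- 1) ^ card {(i, j). i \<in> I \<and> j \<in> J \<and> j < i}"

definition wedge :: "'n::{finite,linorder} form \<Rightarrow> 'n form \<Rightarrow> 'n form" (infixl "\<and>\<^sub>w" 70) where
  "\<alpha> \<and>\<^sub>w \<beta> = (\<chi> K. \<Sum>I\<in>Pow K. wedge_sign I (K - I) * \<alpha> $ I * \<beta> $ (K - I))"

definition dx :: "'n::{finite,linorder} \<Rightarrow> 'n form" where
  "dx i = axis {i} 1"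

definition dxs :: "'n::{finite,linorder} list \<Rightarrow> 'n form" where
  "dxs is = foldr (\<lambda>i \<omega>. dx i \<and>\<^sub>w \<omega>) is (axis {} 1)"

definition partial_deriv :: "'n::finite \<Rightarrow> (complex ^ 'n \<Rightarrow> complex) \<Rightarrow> complex ^ 'n \<Rightarrow> complex" where
  "partial_deriv i f x = deriv (\<lambda>z. f (x + z *s axis i 1)) 0"

definition differential ::
  "(complex ^ 'n::{finite,linorder} \<Rightarrow> complex) \<Rightarrow> complex ^ 'n::{finite,linorder} \<Rightarrow> 'n form" where
  "differential f x = (\<Sum>i\<in>UNIV. partial_deriv i f x *s dx i)"


section \<open>The bracket on \<open>\<complex>\<^sup>6\<close>\<close>

text \<open>
  The coordinate \<open>x_k\<close> is \<open>x $ k\<close> with \<open>k :: 6\<close>.  In this type \<open>6 = 0\<close>, so the library's order on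
  it is \<open>6 < 1 < 2 < 3 < 4 < 5\<close>.  This affects only the choice of the basis \<open>dx_I\<close>: all forms
  below are written as wedge products of the \<open>dx_k\<close>, in the order displayed.
\<close>

definition dV :: "6 form" where
  "dV = dxs [1, 2, 3, 4, 5, 6]"

definition Omega :: "complex ^ 6 \<Rightarrow> 6 form" where
  "Omega x =
      (x$1 * x$3) *s dxs [2,4,5,6] + (x$1 * x$4) *s dxs [2,3,5,6]
    - (x$1 * x$5) *s dxs [2,3,4,6] - (x$1 * x$6) *s dxs [2,3,4,5]
    + (x$2 * x$3) *s dxs [1,4,5,6] + (x$2 * x$4) *s dxs [1,3,5,6]
    - (x$2 * x$5) *s dxs [1,3,4,6] - (x$2 * x$6) *s dxs [1,3,4,5]
    + (x$3 * x$5) *s dxs [1,2,4,6] + (x$3 * x$6) *s dxs [1,2,4,5]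
    + (x$4 * x$5) *s dxs [1,2,3,6] + (x$4 * x$6) *s dxs [1,2,3,5]"

definition over_dV :: "6 form \<Rightarrow> complex" where
  "over_dV \<omega> = (THE c. \<omega> = c *s dV)"

definition Omega_bracket ::
  "(complex ^ 6 \<Rightarrow> complex) \<Rightarrow> (complex ^ 6 \<Rightarrow> complex) \<Rightarrow> complex ^ 6 \<Rightarrow> complex" where
  "Omega_bracket f g = (\<lambda>x. over_dV (Omega x \<and>\<^sub>w differential f x \<and>\<^sub>w differential g x))"


section \<open>Poisson structures and their symmetries\<close>

text \<open>
  A function of several complex variables is holomorphic iff at every point it has a
  (Frechet) derivative that is complex linear.
\<close>

definition holomorphic_functions :: "(complex ^ 'n::finite \<Rightarrow> complex) set" where
  "holomorphic_functions =
    {f. \<forall>x. \<exists>D. (f has_derivative D) (at x) \<and> (\<forall>c v. D (c *s v) = c * D v)}"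

inductive_set polynomial_functions :: "(complex ^ 'n::finite \<Rightarrow> complex) set" where
  const: "(\<lambda>x. c) \<in> polynomial_functions"
| coord: "(\<lambda>x. x $ i) \<in> polynomial_functions"
| add: "\<lbrakk>f \<in> polynomial_functions; g \<in> polynomial_functions\<rbrakk>
    \<Longrightarrow> (\<lambda>x. f x + g x) \<in> polynomial_functions"
| mult: "\<lbrakk>f \<in> polynomial_functions; g \<in> polynomial_functions\<rbrakk>
    \<Longrightarrow> (\<lambda>x. f x * g x) \<in> polynomial_functions"

text \<open>
  In the following, \<open>A\<close> is an algebra of complex functions.  Linearity and the Leibniz rule are
  required in the first argument only; skew-symmetry gives them in the second.
\<close>

definition poisson_structure_on ::
  "('a \<Rightarrow> complex) set \<Rightarrow> (('a \<Rightarrow> complex) \<Rightarrow> ('a \<Rightarrow> complex) \<Rightarrow> 'a \<Rightarrow> complex) \<Rightarrow> bool" where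
  "poisson_structure_on A B \<longleftrightarrow>
    (\<forall>f\<in>A. \<forall>g\<in>A. B f g \<in> A) \<and>
    (\<forall>f\<in>A. \<forall>g\<in>A. \<forall>h\<in>A. \<forall>a b x. B (\<lambda>y. a * f y + b * g y) h x = a * B f h x + b * B g h x) \<and>
    (\<forall>f\<in>A. \<forall>g\<in>A. \<forall>x. B g f x = - B f g x) \<and>
    (\<forall>f\<in>A. \<forall>g\<in>A. \<forall>h\<in>A. \<forall>x. B (\<lambda>y. f y * g y) h x = f x * B g h x + B f h x * g x) \<and>
    (\<forall>f\<in>A. \<forall>g\<in>A. \<forall>h\<in>A. \<forall>x. B f (B g h) x + B g (B h f) x + B h (B f g) x = 0)"

definition invariant_under ::
  "('a \<Rightarrow> complex) set \<Rightarrow> (('a \<Rightarrow> complex) \<Rightarrow> ('a \<Rightarrow> complex) \<Rightarrow> 'a \<Rightarrow> complex) \<Rightarrow> ('a \<Rightarrow> 'a) \<Rightarrow> bool" where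
  "invariant_under A B \<phi> \<longleftrightarrow> bij \<phi> \<and> (\<forall>f\<in>A. \<forall>g\<in>A. \<forall>x. B (f \<circ> \<phi>) (g \<circ> \<phi>) x = B f g (\<phi> x))"

definition anti_invariant_under ::
  "('a \<Rightarrow> complex) set \<Rightarrow> (('a \<Rightarrow> complex) \<Rightarrow> ('a \<Rightarrow> complex) \<Rightarrow> 'a \<Rightarrow> complex) \<Rightarrow> ('a \<Rightarrow> 'a) \<Rightarrow> bool" where
  "anti_invariant_under A B \<phi> \<longleftrightarrow>
    bij \<phi> \<and> (\<forall>f\<in>A. \<forall>g\<in>A. \<forall>x. B (f \<circ> \<phi>) (g \<circ> \<phi>) x = - B f g (\<phi> x))"


section \<open>The maps\<close>

definition nu :: "complex ^ 6 \<Rightarrow> complex ^ 6" where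
  "nu x = vector [x$2, x$1, x$4, x$3, x$6, x$5]"

text \<open>The indices of \<open>lam i j\<close> are representatives of classes in \<open>\<int>/2\<close>; only their parity matters.\<close>

definition lam :: "nat \<Rightarrow> nat \<Rightarrow> complex ^ 6 \<Rightarrow> complex ^ 6" where
  "lam i j x = vector [(-1)^i * x$1, (-1)^i * x$2, (-1)^(i+j) * x$3, (-1)^(i+j) * x$4,
     (-1)^j * x$5, (-1)^j * x$6]"

definition sigma1 :: "complex ^ 6 \<Rightarrow> complex ^ 6" where
  "sigma1 x = vector [x$3, x$4, x$1, x$2, x$5, x$6]"

definition sigma2 :: "complex ^ 6 \<Rightarrow> complex ^ 6" where
  "sigma2 x = vector [x$1, x$2, x$5, x$6, x$3, x$4]"

definition tau1 :: "complex ^ 6 \<Rightarrow> complex ^ 6" where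
  "tau1 x = vector [- x$2, - x$1, x$6, x$5, x$4 - x$1 * x$5, x$3 - x$2 * x$6]"

definition tau2 :: "complex ^ 6 \<Rightarrow> complex ^ 6" where
  "tau2 x = vector [x$4, x$3, x$2 - x$3 * x$5, x$1 - x$4 * x$6, - x$6, - x$5]"

end

theory Submission
  imports Defs "HOL-Complex_Analysis.Cauchy_Integral_Formula"
begin

text \<open>
  In each term \<open>x_a x_b dx_K\<close> of \<open>Omega\<close> the indices \<open>a\<close>, \<open>b\<close> are exactly those missing from \<open>K\<close>.
  Therefore the bracket is log-canonical: \<open>{x_i, x_j} = c_ij x_i x_j\<close> with a constant skew-symmetric
  matrix \<open>c\<close>, called \<open>omega_matrix\<close> below (\<open>Omega_bracket_log_canonical\<close>).  Equivalently,
  \<open>{f, g}\<close> is the sum of all \<open>c_ij (D_i f) (D_j g)\<close>, where \<open>D_i = x_i d/dx_i\<close>.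

  Every log-canonical bracket is a Poisson bracket.  The \<open>D_i\<close> are commuting derivations and \<open>c\<close> is
  constant, so in the Jacobi sum the terms cancel in pairs
  (\<open>log_canonical_bracket_Jacobi\<close>).  For holomorphic functions, which are only assumed to have a
  complex linear derivative everywhere, this uses that the partial derivatives are again holomorphic
  and commute; both facts follow from Cauchy's integral formula in one variable, by differentiating
  under the integral sign and by Fubini (\<open>partial_deriv_holomorphic\<close>, \<open>partial_deriv_commute\<close>).

  By the chain rule, (anti-)invariance under a map need only be tested on the coordinates
  (\<open>log_canonical_bracket_compose\<close>): the components \<open>y_k\<close> of the map have to satisfy
  \<open>{y_k, y_l} = c_kl y_k y_l\<close>, with a minus sign in the anti-invariant case.  That is a finite
  verification, whose outcome is explained by the sign pattern of \<open>c\<close>.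
\<close>

section \<open>Holomorphic functions of several variables\<close>

lemma bounded_linear_vector_scalar_mult:
  fixes v :: "complex ^ 'n::finite"
  shows "bounded_linear (\<lambda>z. z *s v)"
  unfolding linear_conv_bounded_linear[symmetric]
  by (rule linearI) (simp_all add: vec_eq_iff algebra_simps)

lemma has_derivative_along_line:
  fixes f :: "complex ^ 'n::finite \<Rightarrow> complex"
  assumes "(f has_derivative D) (at (x + z *s v))" "\<And>c v. D (c *s v) = c * D v"
  shows "((\<lambda>z. f (x + z *s v)) has_field_derivative D v) (at z)"
proof -
  have "((\<lambda>z. x + z *s v) has_derivative (\<lambda>h. h *s v)) (at z)"
    using bounded_linear_imp_has_derivative[OF bounded_linear_vector_scalar_mult[of v]]
    by (auto intro!: derivative_eq_intros)
  from diff_chain_at[OF this assms(1)]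
  have "((\<lambda>z. f (x + z *s v)) has_derivative (\<lambda>h. D v * h)) (at z)"
    by (simp add: o_def assms(2) mult.commute)
  then show ?thesis
    by (simp add: has_field_derivative_def)
qed

lemma partial_deriv_eq:
  fixes f :: "complex ^ 'n::finite \<Rightarrow> complex"
  assumes "(f has_derivative D) (at x)" "\<And>c v. D (c *s v) = c * D v"
  shows "partial_deriv i f x = D (axis i 1)"
  unfolding partial_deriv_def
  by (rule DERIV_imp_deriv, rule has_derivative_along_line) (use assms in simp_all)

lemma holomorphic_functions_has_derivative:
  fixes f :: "complex ^ 'n::finite \<Rightarrow> complex"
  assumes "f \<in> holomorphic_functions"
  shows "(f has_derivative (\<lambda>v. \<Sum>i\<in>UNIV. v $ i * partial_deriv i f x)) (at x)"
proof -
  obtain D where D: "(f has_derivative D) (at x)" and lin: "\<And>c v. D (c *s v) = c * D v"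
    using assms unfolding holomorphic_functions_def by blast
  interpret D: bounded_linear D
    using D by (rule has_derivative_bounded_linear)
  have "D v = (\<Sum>i\<in>UNIV. v $ i * partial_deriv i f x)" for v
  proof -
    have "D v = D (\<Sum>i\<in>UNIV. (v $ i) *s axis i 1)"
      by (simp add: basis_expansion)
    also have "\<dots> = (\<Sum>i\<in>UNIV. v $ i * D (axis i 1))"
      by (simp add: D.sum lin)
    finally show ?thesis
      by (simp add: partial_deriv_eq[OF D lin])
  qed
  then show ?thesis
    using D by (metis (no_types, lifting) ext)
qed

text \<open>
  One computation of a total derivative yields both membership and the partial derivatives; the
  closure properties below all arise in this way.
\<close>

lemma holomorphic_functionsI:
  fixes f :: "complex ^ 'n::finite \<Rightarrow> complex"
  assumes "\<And>x. (f has_derivative (\<lambda>v. \<Sum>i\<in>UNIV. v $ i * J i x)) (at x)"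
  shows "f \<in> holomorphic_functions" and "partial_deriv i f x = J i x"
proof -
  have lin: "(\<Sum>i\<in>UNIV. (c *s v) $ i * J i x) = c * (\<Sum>i\<in>UNIV. v $ i * J i x)" for c v x
    by (simp add: sum_distrib_left mult.assoc)
  show "f \<in> holomorphic_functions"
    unfolding holomorphic_functions_def using assms lin by blast
  have "partial_deriv i f x = (\<Sum>j\<in>UNIV. axis i 1 $ j * J j x)"
    by (rule partial_deriv_eq[OF assms lin])
  also have "\<dots> = J i x"
    by (simp add: axis_def if_distrib[of "\<lambda>c. c * _"] cong: if_cong)
  finally show "partial_deriv i f x = J i x" .
qed

lemma
  fixes x :: "complex ^ 'n::finite"
  shows holomorphic_functions_const: "(\<lambda>x::complex ^ 'n. c) \<in> holomorphic_functions"
  and partial_deriv_const [simp]: "partial_deriv i (\<lambda>x. c) x = 0"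
proof -
  have *: "((\<lambda>x. c) has_derivative (\<lambda>v. \<Sum>i\<in>UNIV. v $ i * 0)) (at x)" for x :: "complex ^ 'n"
    by simp
  show "(\<lambda>x::complex ^ 'n. c) \<in> holomorphic_functions" "partial_deriv i (\<lambda>x. c) x = 0"
    using holomorphic_functionsI[OF *] by blast+
qed

lemma
  fixes x :: "complex ^ 'n::finite"
  shows holomorphic_functions_coord: "(\<lambda>x. x $ k) \<in> holomorphic_functions"
  and partial_deriv_coord [simp]: "partial_deriv i (\<lambda>x. x $ k) x = (if i = k then 1 else 0)"
proof -
  have *: "((\<lambda>x. x $ k) has_derivative (\<lambda>v. \<Sum>i\<in>UNIV. v $ i * (if i = k then 1 else 0))) (at x)"
    for x :: "complex ^ 'n"
    by (simp add: if_distrib[of "\<lambda>c. _ * c"] bounded_linear_imp_has_derivative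
        bounded_linear_vec_nth cong: if_cong)
  show "(\<lambda>x. x $ k) \<in> holomorphic_functions"
    "partial_deriv i (\<lambda>x. x $ k) x = (if i = k then 1 else 0)"
    using holomorphic_functionsI[OF *] by blast+
qed

context
  fixes f g :: "complex ^ 'n::finite \<Rightarrow> complex"
  assumes f: "f \<in> holomorphic_functions" and g: "g \<in> holomorphic_functions"
begin

lemma holomorphic_functions_add: "(\<lambda>x. f x + g x) \<in> holomorphic_functions"
  and partial_deriv_add:
    "partial_deriv i (\<lambda>x. f x + g x) x = partial_deriv i f x + partial_deriv i g x"
proof -
  have *: "((\<lambda>x. f x + g x) has_derivative
      (\<lambda>v. \<Sum>i\<in>UNIV. v $ i * (partial_deriv i f x + partial_deriv i g x))) (at x)" for x
    by (auto intro!: derivative_eq_intros holomorphic_functions_has_derivative f g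
        simp: fun_eq_iff algebra_simps sum.distrib)
  show "(\<lambda>x. f x + g x) \<in> holomorphic_functions"
    "partial_deriv i (\<lambda>x. f x + g x) x = partial_deriv i f x + partial_deriv i g x"
    using holomorphic_functionsI[OF *] by blast+
qed

lemma holomorphic_functions_mult: "(\<lambda>x. f x * g x) \<in> holomorphic_functions"
  and partial_deriv_mult:
    "partial_deriv i (\<lambda>x. f x * g x) x = partial_deriv i f x * g x + f x * partial_deriv i g x"
proof -
  have *: "((\<lambda>x. f x * g x) has_derivative
      (\<lambda>v. \<Sum>i\<in>UNIV. v $ i * (partial_deriv i f x * g x + f x * partial_deriv i g x))) (at x)" for x
    by (auto intro!: derivative_eq_intros holomorphic_functions_has_derivative f g
        simp: fun_eq_iff algebra_simps sum.distrib sum_distrib_left sum_distrib_right)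
  show "(\<lambda>x. f x * g x) \<in> holomorphic_functions"
    "partial_deriv i (\<lambda>x. f x * g x) x = partial_deriv i f x * g x + f x * partial_deriv i g x"
    using holomorphic_functionsI[OF *] by blast+
qed

end

lemma partial_deriv_compose:
  fixes f :: "complex ^ 'n::finite \<Rightarrow> complex" and \<phi> :: "complex ^ 'm::finite \<Rightarrow> complex ^ 'n"
  assumes f: "f \<in> holomorphic_functions"
    and \<phi>: "\<And>k. (\<lambda>x. \<phi> x $ k) \<in> holomorphic_functions"
  shows "partial_deriv i (f \<circ> \<phi>) x =
    (\<Sum>k\<in>UNIV. partial_deriv k f (\<phi> x) * partial_deriv i (\<lambda>x. \<phi> x $ k) x)"
proof -
  define J where "J k i x = partial_deriv i (\<lambda>x. \<phi> x $ k) x" for k i x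
  have "(\<phi> has_derivative (\<lambda>v. \<chi> k. \<Sum>i\<in>UNIV. v $ i * J k i x)) (at x)" for x
    unfolding J_def
    by (subst has_derivative_componentwise_within)
      (auto simp: Basis_vec_def inner_axis intro!: derivative_intros
        holomorphic_functions_has_derivative \<phi>)
  from diff_chain_at[OF this holomorphic_functions_has_derivative[OF f]]
  have *: "(f \<circ> \<phi> has_derivative
      (\<lambda>v. \<Sum>i\<in>UNIV. v $ i * (\<Sum>k\<in>UNIV. partial_deriv k f (\<phi> x) * J k i x))) (at x)" for x
    by (simp add: o_def sum_distrib_left sum_distrib_right mult_ac)
      (subst sum.swap, simp add: mult_ac)
  show ?thesis
    using holomorphic_functionsI(2)[OF *] by (simp add: J_def)
qed

abbreviation unit_circle :: "real \<Rightarrow> complex" where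
  "unit_circle \<equiv> circlepath 0 1"

lemma unit_circle_nonzero [simp]: "unit_circle t \<noteq> 0"
  by (simp add: circlepath)

lemma continuous_on_unit_circle [continuous_intros]:
  "continuous_on S h \<Longrightarrow> continuous_on S (\<lambda>x. unit_circle (h x))"
  unfolding circlepath by (intro continuous_intros)

lemma continuous_on_vector_scalar_mult [continuous_intros]:
  fixes v :: "complex ^ 'n::finite"
  shows "continuous_on S h \<Longrightarrow> continuous_on S (\<lambda>x. h x *s v)"
  using bounded_linear.continuous_on[OF bounded_linear_vector_scalar_mult] by blast

lemma holomorphic_functions_continuous_on:
  "f \<in> holomorphic_functions \<Longrightarrow> continuous_on S f"
  by (meson continuous_at_imp_continuous_on has_derivative_continuous
      holomorphic_functions_has_derivative)

text \<open>
  Parametrising the circle by \<open>[0, 1]\<close> turns the factor \<open>dz / (2 * pi * \<i> * z^2)\<close> of Cauchy's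
  formula for the derivative at the centre into \<open>dt / z\<close>.  On the right-hand side \<open>f\<close> is not
  differentiated, so that properties of \<open>f\<close> pass to its partial derivatives under the integral sign.
\<close>

lemma partial_deriv_Cauchy:
  fixes f :: "complex ^ 'n::finite \<Rightarrow> complex"
  assumes f: "f \<in> holomorphic_functions"
  shows "partial_deriv i f x =
    integral (cbox 0 1) (\<lambda>t. f (x + unit_circle t *s axis i 1) / unit_circle t)"
proof -
  let ?u = "\<lambda>z. f (x + z *s axis i 1)"
  have u: "(?u has_field_derivative (\<Sum>k\<in>UNIV. axis i 1 $ k * partial_deriv k f (x + z *s axis i 1)))
      (at z)" for z
    by (rule has_derivative_along_line[OF holomorphic_functions_has_derivative[OF f]])
      (simp add: sum_distrib_left mult.assoc)
  then have hol: "?u holomorphic_on S" for S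
    by (meson field_differentiable_at_within field_differentiable_def holomorphic_on_def)
  have "(?u has_field_derivative
      (1 / (2 * of_real pi * \<i>) * contour_integral unit_circle (\<lambda>w. ?u w / (w - 0)^2))) (at 0)"
    by (rule Cauchy_derivative_integral_circlepath(2))
      (auto intro: hol holomorphic_on_imp_continuous_on)
  then have "partial_deriv i f x =
      1 / (2 * of_real pi * \<i>) * contour_integral unit_circle (\<lambda>w. ?u w / w^2)"
    by (simp add: partial_deriv_def DERIV_imp_deriv)
  also have "\<dots> = 1 / (2 * of_real pi * \<i>) *
      integral {0..1} (\<lambda>t. 2 * of_real pi * \<i> * (?u (unit_circle t) / unit_circle t))"
    unfolding contour_integral_integral vector_derivative_circlepath
    by (simp add: circlepath power2_eq_square field_simps)
  also have "\<dots> = integral (cbox 0 1) (\<lambda>t. ?u (unit_circle t) / unit_circle t)"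
    by (subst integral_mult_right) simp
  finally show ?thesis .
qed

lemma continuous_on_partial_deriv:
  assumes f: "f \<in> holomorphic_functions"
  shows "continuous_on S (partial_deriv i f)"
proof -
  have "continuous_on (UNIV \<times> cbox 0 1) (\<lambda>(x, t). f (x + unit_circle t *s axis i 1) / unit_circle t)"
    unfolding case_prod_beta
    by (intro continuous_intros continuous_on_compose2[OF holomorphic_functions_continuous_on[OF f, of UNIV]])
      auto
  then have "continuous_on UNIV (partial_deriv i f)"
    using integral_continuous_on_param[of UNIV 0 1
      "\<lambda>x t. f (x + unit_circle t *s axis i 1) / unit_circle t"]
    by (simp add: partial_deriv_Cauchy[OF f])
  then show ?thesis
    using continuous_on_subset by blast
qed

text \<open>
  Differentiation under the integral sign in Cauchy's formula.  This needs the total derivative of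
  \<open>f\<close> to be continuous, which holds because the partial derivatives are.  The resulting derivative is
  an integral of complex linear maps, hence complex linear.
\<close>

lemma partial_deriv_holomorphic:
  fixes f :: "complex ^ 'n::finite \<Rightarrow> complex"
  assumes f: "f \<in> holomorphic_functions"
  shows "partial_deriv i f \<in> holomorphic_functions"
proof -
  define c where "c x t k = partial_deriv k f (x + unit_circle t *s axis i 1) / unit_circle t"
    for x t k
  (* D x t is the total derivative in x of the integrand at t. *)
  define D where "D x t =
    (\<Sum>k\<in>UNIV. blinfun_mult_right (c x t k) o\<^sub>L Blinfun (\<lambda>v. v $ k))" for x t
  have D_apply: "D x t v = (\<Sum>k\<in>UNIV. v $ k * c x t k)" for x t v
    by (simp add: D_def blinfun.sum_left bounded_linear_Blinfun_apply bounded_linear_vec_nth mult.commute)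
  have deriv: "((\<lambda>x. f (x + unit_circle t *s axis i 1) / unit_circle t) has_derivative D x t) (at x)" for x t
  proof -
    have "((\<lambda>x. x + unit_circle t *s axis i 1) has_derivative (\<lambda>v. v)) (at x)"
      by (auto intro!: derivative_eq_intros)
    from diff_chain_at[OF this holomorphic_functions_has_derivative[OF f]]
    have "((\<lambda>x. f (x + unit_circle t *s axis i 1)) has_derivative
        (\<lambda>v. \<Sum>k\<in>UNIV. v $ k * partial_deriv k f (x + unit_circle t *s axis i 1))) (at x)"
      by (simp add: o_def)
    from bounded_linear.has_derivative[OF bounded_linear_divide this, of "unit_circle t"]
    moreover have "blinfun_apply (D x t) = (\<lambda>v. (\<Sum>k\<in>UNIV.
        v $ k * partial_deriv k f (x + unit_circle t *s axis i 1)) / unit_circle t)"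
      by (simp add: fun_eq_iff D_apply c_def sum_divide_distrib)
    ultimately show ?thesis
      by simp
  qed
  have cont_c: "continuous_on S (\<lambda>p. c (fst p) (snd p) k)" for S k
    unfolding c_def
    by (intro continuous_intros continuous_on_compose2[OF continuous_on_partial_deriv[OF f, of UNIV]]) auto
  have cont_D: "continuous_on S (\<lambda>(x, t). D x t)" for S
    unfolding D_def case_prod_beta
    by (intro continuous_intros cont_c
        bounded_linear.continuous_on[OF bounded_linear_blinfun_mult_right])
  have "((\<lambda>x. integral (cbox 0 1) (\<lambda>t. f (x + unit_circle t *s axis i 1) / unit_circle t))
      has_derivative integral (cbox 0 1) (D x)) (at x within UNIV)" for x
  proof (rule leibniz_rule)
    show "(\<lambda>t. f (x + unit_circle t *s axis i 1) / unit_circle t) integrable_on cbox 0 1" for x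
      by (intro integrable_continuous continuous_intros
          continuous_on_compose2[OF holomorphic_functions_continuous_on[OF f, of UNIV]]) auto
  qed (use deriv cont_D in auto)
  then have *: "(partial_deriv i f has_derivative integral (cbox 0 1) (D x)) (at x)" for x
    by (simp add: partial_deriv_Cauchy[OF f, abs_def])
  have "integral (cbox 0 1) (D x) (a *s v) = a * integral (cbox 0 1) (D x) v" for x a v
  proof -
    have "continuous_on (cbox 0 1) (D x)"
      using continuous_on_compose2[OF cont_D[of UNIV] continuous_on_Pair[OF continuous_on_const continuous_on_id]]
      by simp
    then have "D x integrable_on cbox 0 1"
      by (rule integrable_continuous)
    then have *: "integral (cbox 0 1) (D x) w = integral (cbox 0 1) (\<lambda>t. D x t w)" for w
      by (rule blinfun_apply_integral)
    have "D x t (a *s v) = a * D x t v" for t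
      by (simp add: D_apply sum_distrib_left mult.assoc)
    then show ?thesis
      unfolding * by simp
  qed
  with * show ?thesis
    unfolding holomorphic_functions_def by blast
qed

text \<open>
  Both mixed derivatives are the same double integral over the torus, by Fubini.
\<close>

lemma partial_deriv_commute:
  fixes f :: "complex ^ 'n::finite \<Rightarrow> complex"
  assumes f: "f \<in> holomorphic_functions"
  shows "partial_deriv i (partial_deriv j f) x = partial_deriv j (partial_deriv i f) x"
proof -
  let ?F = "\<lambda>i j s t. f (x + unit_circle s *s axis i 1 + unit_circle t *s axis j 1)
    / unit_circle t / unit_circle s"
  have iterated: "partial_deriv i (partial_deriv j f) x =
      integral (cbox 0 1) (\<lambda>s. integral (cbox 0 1) (?F i j s))" for i j
    unfolding partial_deriv_Cauchy[OF partial_deriv_holomorphic[OF f]] partial_deriv_Cauchy[OF f]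
      integral_divide ..
  have "continuous_on (cbox (0, 0) (1, 1)) (\<lambda>(s, t). ?F i j s t)"
    unfolding case_prod_beta
    by (intro continuous_intros continuous_on_compose2[OF holomorphic_functions_continuous_on[OF f, of UNIV]])
      auto
  then have "integral (cbox 0 1) (\<lambda>s. integral (cbox 0 1) (?F i j s)) =
      integral (cbox 0 1) (\<lambda>t. integral (cbox 0 1) (\<lambda>s. ?F i j s t))"
    by (rule integral_swap_continuous)
  also have "\<dots> = integral (cbox 0 1) (\<lambda>t. integral (cbox 0 1) (?F j i t))"
    by (simp add: add_ac mult_ac)
  finally show ?thesis
    by (simp only: iterated)
qed

lemma polynomial_functions_subset_holomorphic: "polynomial_functions \<subseteq> holomorphic_functions"
proof
  fix f :: "complex ^ 'n::finite \<Rightarrow> complex"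
  assume "f \<in> polynomial_functions"
  then show "f \<in> holomorphic_functions"
    by induction (auto intro: holomorphic_functions_const holomorphic_functions_coord
        holomorphic_functions_add holomorphic_functions_mult)
qed

lemma partial_deriv_polynomial:
  assumes "f \<in> polynomial_functions"
  shows "partial_deriv i f \<in> polynomial_functions"
  using assms
proof induction
  case (const c)
  have "partial_deriv i (\<lambda>x. c) = (\<lambda>x. 0)"
    by (rule ext) simp
  then show ?case
    by (simp add: polynomial_functions.const)
next
  case (coord k)
  have "partial_deriv i (\<lambda>x. x $ k) = (\<lambda>x. if i = k then 1 else 0)"
    by (rule ext) simp
  then show ?case
    by (simp add: polynomial_functions.const)
next
  case (add f g)
  then have "partial_deriv i (\<lambda>x. f x + g x) = (\<lambda>x. partial_deriv i f x + partial_deriv i g x)"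
    using polynomial_functions_subset_holomorphic by (intro ext partial_deriv_add) auto
  with add show ?case
    by (simp add: polynomial_functions.add)
next
  case (mult f g)
  then have "partial_deriv i (\<lambda>x. f x * g x) =
      (\<lambda>x. partial_deriv i f x * g x + f x * partial_deriv i g x)"
    using polynomial_functions_subset_holomorphic by (intro ext partial_deriv_mult) auto
  with mult show ?case
    by (simp add: polynomial_functions.add polynomial_functions.mult)
qed

section \<open>Log-canonical brackets\<close>

text \<open>
  The derivation \<open>x_i d/dx_i\<close>, the derivative with respect to the logarithm of \<open>x_i\<close>.
\<close>

definition log_deriv :: "'n::finite \<Rightarrow> (complex ^ 'n \<Rightarrow> complex) \<Rightarrow> complex ^ 'n \<Rightarrow> complex" where
  "log_deriv i f x = x $ i * partial_deriv i f x"

lemma log_deriv_holomorphic: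
  "f \<in> holomorphic_functions \<Longrightarrow> log_deriv i f \<in> holomorphic_functions"
  unfolding log_deriv_def[abs_def]
  by (intro holomorphic_functions_mult holomorphic_functions_coord partial_deriv_holomorphic)

lemma log_deriv_const [simp]: "log_deriv i (\<lambda>x. c) x = 0"
  by (simp add: log_deriv_def)

lemma
  assumes "f \<in> holomorphic_functions" "g \<in> holomorphic_functions"
  shows log_deriv_add: "log_deriv i (\<lambda>x. f x + g x) x = log_deriv i f x + log_deriv i g x"
    and log_deriv_mult: "log_deriv i (\<lambda>x. f x * g x) x = log_deriv i f x * g x + f x * log_deriv i g x"
  using assms by (simp_all add: log_deriv_def partial_deriv_add partial_deriv_mult algebra_simps)

lemma
  assumes "\<And>k. k \<in> S \<Longrightarrow> f k \<in> holomorphic_functions"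
  shows holomorphic_functions_sum: "(\<lambda>x. \<Sum>k\<in>S. f k x) \<in> holomorphic_functions"
    and log_deriv_sum: "log_deriv i (\<lambda>x. \<Sum>k\<in>S. f k x) x = (\<Sum>k\<in>S. log_deriv i (f k) x)"
  using assms
  by (induction S rule: infinite_finite_induct)
    (simp_all add: holomorphic_functions_const holomorphic_functions_add log_deriv_add)

lemma log_deriv_commute:
  assumes f: "f \<in> holomorphic_functions"
  shows "log_deriv i (log_deriv j f) x = log_deriv j (log_deriv i f) x"
proof -
  have "log_deriv i (log_deriv j f) x =
      x $ i * ((if i = j then 1 else 0) * partial_deriv j f x + x $ j * partial_deriv i (partial_deriv j f) x)"
    for i j
    unfolding log_deriv_def[of j f, abs_def] log_deriv_def[of i]
    by (simp add: partial_deriv_mult holomorphic_functions_coord partial_deriv_holomorphic[OF f])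
  then show ?thesis
    using partial_deriv_commute[OF f] by (simp add: algebra_simps)
qed

lemma
  assumes "f \<in> holomorphic_functions" "g \<in> holomorphic_functions"
  shows holomorphic_functions_diff: "(\<lambda>x. f x - g x) \<in> holomorphic_functions"
    and log_deriv_diff: "log_deriv i (\<lambda>x. f x - g x) x = log_deriv i f x - log_deriv i g x"
  using holomorphic_functions_add[OF assms(1) holomorphic_functions_mult[OF holomorphic_functions_const[of "-1"] assms(2)]]
    log_deriv_add[OF assms(1) holomorphic_functions_mult[OF holomorphic_functions_const[of "-1"] assms(2)]]
    log_deriv_mult[OF holomorphic_functions_const[of "-1"] assms(2)]
  by simp_all

lemma
  assumes "f \<in> holomorphic_functions"
  shows holomorphic_functions_minus: "(\<lambda>x. - f x) \<in> holomorphic_functions"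
    and log_deriv_minus: "log_deriv i (\<lambda>x. - f x) x = - log_deriv i f x"
  using holomorphic_functions_diff[OF holomorphic_functions_const[of 0] assms]
    log_deriv_diff[OF holomorphic_functions_const[of 0] assms]
  by simp_all

lemma log_deriv_coord: "log_deriv i (\<lambda>x. x $ k) x = (if i = k then x $ k else 0)"
  by (simp add: log_deriv_def)

definition log_canonical_bracket ::
  "complex ^ 'n ^ 'n \<Rightarrow> (complex ^ 'n::finite \<Rightarrow> complex) \<Rightarrow>
    (complex ^ 'n \<Rightarrow> complex) \<Rightarrow> complex ^ 'n \<Rightarrow> complex"
  where "log_canonical_bracket c f g x =
    (\<Sum>i\<in>UNIV. \<Sum>j\<in>UNIV. c $ i $ j * log_deriv i f x * log_deriv j g x)"

lemma log_canonical_bracket_linear_left: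
  assumes "f \<in> holomorphic_functions" "g \<in> holomorphic_functions"
  shows "log_canonical_bracket c (\<lambda>y. a * f y + b * g y) h x =
    a * log_canonical_bracket c f h x + b * log_canonical_bracket c g h x"
  using assms
  by (simp add: log_canonical_bracket_def log_deriv_add log_deriv_mult holomorphic_functions_mult
      holomorphic_functions_const algebra_simps sum.distrib sum_distrib_left)

lemma log_canonical_bracket_Leibniz_left:
  assumes "f \<in> holomorphic_functions" "g \<in> holomorphic_functions"
  shows "log_canonical_bracket c (\<lambda>y. f y * g y) h x =
    f x * log_canonical_bracket c g h x + log_canonical_bracket c f h x * g x"
  using assms
  by (simp add: log_canonical_bracket_def log_deriv_mult algebra_simps sum.distrib sum_distrib_left)

lemma log_canonical_bracket_skew:
  assumes skew: "\<And>i j. c $ j $ i = - (c $ i $ j)"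
  shows "log_canonical_bracket c g f x = - log_canonical_bracket c f g x"
proof -
  have "log_canonical_bracket c g f x =
      (\<Sum>j\<in>UNIV. \<Sum>i\<in>UNIV. c $ i $ j * log_deriv i g x * log_deriv j f x)"
    unfolding log_canonical_bracket_def by (rule sum.swap)
  also have "\<dots> = - log_canonical_bracket c f g x"
    unfolding log_canonical_bracket_def sum_negf[symmetric]
    by (intro sum.cong refl) (subst skew, simp)
  finally show ?thesis .
qed

lemma
  assumes "f \<in> holomorphic_functions" "g \<in> holomorphic_functions"
  shows log_canonical_bracket_diff_left: "log_canonical_bracket c (\<lambda>y. f y - g y) h x =
      log_canonical_bracket c f h x - log_canonical_bracket c g h x"
    and log_canonical_bracket_diff_right: "log_canonical_bracket c h (\<lambda>y. f y - g y) x =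
      log_canonical_bracket c h f x - log_canonical_bracket c h g x"
    and log_canonical_bracket_Leibniz_right: "log_canonical_bracket c h (\<lambda>y. f y * g y) x =
      f x * log_canonical_bracket c h g x + log_canonical_bracket c h f x * g x"
  using assms
  by (simp_all add: log_canonical_bracket_def log_deriv_diff log_deriv_mult algebra_simps
      sum.distrib sum_subtractf sum_distrib_left)

lemma log_canonical_bracket_minus:
  assumes "f \<in> holomorphic_functions"
  shows "log_canonical_bracket c (\<lambda>y. - f y) h x = - log_canonical_bracket c f h x"
    and "log_canonical_bracket c h (\<lambda>y. - f y) x = - log_canonical_bracket c h f x"
  using assms by (simp_all add: log_canonical_bracket_def log_deriv_minus sum_negf)

lemma log_canonical_bracket_const:
  "log_canonical_bracket c (\<lambda>y. a) h x = 0"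
  "log_canonical_bracket c h (\<lambda>y. a) x = 0"
  by (simp_all add: log_canonical_bracket_def)

lemma log_canonical_bracket_coord:
  "log_canonical_bracket c (\<lambda>x. x $ k) (\<lambda>x. x $ l) x = c $ k $ l * (x $ k * x $ l)"
  by (simp add: log_canonical_bracket_def log_deriv_coord if_distrib[of "\<lambda>z. _ * z"]
      if_distrib[of "\<lambda>z. z * _"] cong: if_cong)

text \<open>
  The inner sum is the component along \<open>log_deriv j\<close> of the Hamiltonian vector field of \<open>f\<close>.
\<close>

lemma log_canonical_bracket_Hamiltonian:
  "log_canonical_bracket c f g x =
    (\<Sum>j\<in>UNIV. (\<Sum>i\<in>UNIV. c $ i $ j * log_deriv i f x) * log_deriv j g x)"
  unfolding log_canonical_bracket_def
  by (subst sum.swap) (simp add: sum_distrib_right)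

text \<open>
  Since the coefficients are constant, every term of the cyclic sum contains a second derivative of one
  of the three functions.  Those of one function add up to its Hessian with respect to the
  \<open>log_deriv\<close>s, evaluated on the Hamiltonian vector fields of the other two, once in either order and
  with opposite signs.  They cancel because the Hessian is symmetric.
\<close>

lemma log_canonical_bracket_Jacobi:
  fixes c :: "complex ^ 'n::finite ^ 'n"
  assumes skew: "\<And>i j. c $ j $ i = - (c $ i $ j)"
    and "f \<in> holomorphic_functions" "g \<in> holomorphic_functions" "h \<in> holomorphic_functions"
  shows "log_canonical_bracket c f (log_canonical_bracket c g h) x
    + log_canonical_bracket c g (log_canonical_bracket c h f) x
    + log_canonical_bracket c h (log_canonical_bracket c f g) x = 0"
proof -
  define X where "X u j = (\<Sum>i\<in>UNIV. c $ i $ j * log_deriv i u x)" for u j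
  define H where "H u v w =
    (\<Sum>k\<in>UNIV. \<Sum>a\<in>UNIV. X u k * log_deriv k (log_deriv a v) x * X w a)" for u v w
  have H_sym: "H w v u = H u v w" if v: "v \<in> holomorphic_functions" for u v w
    unfolding H_def
    by (subst sum.swap, intro sum.cong refl) (simp add: log_deriv_commute[OF v] mult_ac)
  have X_row: "(\<Sum>b\<in>UNIV. c $ a $ b * log_deriv b w x) = - X w a" for w a
    unfolding X_def sum_negf[symmetric] by (intro sum.cong refl) (subst skew, simp)
  have nested: "log_canonical_bracket c u (log_canonical_bracket c v w) x = H u w v - H u v w"
    if v: "v \<in> holomorphic_functions" and w: "w \<in> holomorphic_functions" for u v w
  proof -
    have "log_deriv k (log_canonical_bracket c v w) x = (\<Sum>a\<in>UNIV. \<Sum>b\<in>UNIV. c $ a $ b *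
        (log_deriv k (log_deriv a v) x * log_deriv b w x + log_deriv a v x * log_deriv k (log_deriv b w) x))"
      for k
      unfolding log_canonical_bracket_def[abs_def]
      by (simp add: log_deriv_sum holomorphic_functions_sum log_deriv_mult holomorphic_functions_mult
          holomorphic_functions_const log_deriv_holomorphic v w algebra_simps)
    moreover have "(\<Sum>a\<in>UNIV. \<Sum>b\<in>UNIV. c $ a $ b *
        (log_deriv k (log_deriv a v) x * log_deriv b w x + log_deriv a v x * log_deriv k (log_deriv b w) x))
        = (\<Sum>a\<in>UNIV. log_deriv k (log_deriv a v) x * (\<Sum>b\<in>UNIV. c $ a $ b * log_deriv b w x))
        + (\<Sum>a\<in>UNIV. \<Sum>b\<in>UNIV. c $ a $ b * log_deriv a v x * log_deriv k (log_deriv b w) x)" for k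
      by (simp add: sum_distrib_left sum.distrib algebra_simps)
    moreover have "(\<Sum>a\<in>UNIV. \<Sum>b\<in>UNIV. c $ a $ b * log_deriv a v x * log_deriv k (log_deriv b w) x)
        = (\<Sum>b\<in>UNIV. X v b * log_deriv k (log_deriv b w) x)" for k
      unfolding X_def by (subst sum.swap) (simp add: sum_distrib_right)
    ultimately have expand: "log_deriv k (log_canonical_bracket c v w) x =
        (\<Sum>b\<in>UNIV. X v b * log_deriv k (log_deriv b w) x)
        - (\<Sum>a\<in>UNIV. log_deriv k (log_deriv a v) x * X w a)" for k
      by (simp add: X_row sum_negf)
    show ?thesis
      unfolding log_canonical_bracket_Hamiltonian[of c u] X_def[symmetric] H_def expand
      by (simp add: sum_distrib_left sum_subtractf algebra_simps)
  qed
  show ?thesis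
    using assms H_sym[of f h g] H_sym[of g f h] H_sym[of h g f] by (simp add: nested)
qed

lemma poisson_structure_on_log_canonical_bracket:
  fixes A :: "(complex ^ 'n::finite \<Rightarrow> complex) set"
  assumes skew: "\<And>i j. c $ j $ i = - (c $ i $ j)"
    and hol: "A \<subseteq> holomorphic_functions"
    and const: "\<And>a. (\<lambda>x. a) \<in> A" and coord: "\<And>i. (\<lambda>x. x $ i) \<in> A"
    and add: "\<And>f g. f \<in> A \<Longrightarrow> g \<in> A \<Longrightarrow> (\<lambda>x. f x + g x) \<in> A"
    and mult: "\<And>f g. f \<in> A \<Longrightarrow> g \<in> A \<Longrightarrow> (\<lambda>x. f x * g x) \<in> A"
    and partial_deriv: "\<And>f i. f \<in> A \<Longrightarrow> partial_deriv i f \<in> A"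
  shows "poisson_structure_on A (log_canonical_bracket c)"
proof -
  have sum: "(\<lambda>x. \<Sum>i\<in>S. F i x) \<in> A" if "\<And>i. F i \<in> A" for F and S :: "'n set"
    using that by (induction S rule: infinite_finite_induct) (auto intro: const add)
  have "log_canonical_bracket c f g \<in> A" if "f \<in> A" "g \<in> A" for f g
    unfolding log_canonical_bracket_def[abs_def] log_deriv_def
    by (intro sum mult const coord partial_deriv that)
  then show ?thesis
    unfolding poisson_structure_on_def
    by (intro conjI ballI allI log_canonical_bracket_linear_left log_canonical_bracket_skew[OF skew]
        log_canonical_bracket_Leibniz_left log_canonical_bracket_Jacobi[OF skew] subsetD[OF hol])
qed

section \<open>Pulling back a log-canonical bracket\<close>

lemma log_canonical_bracket_compose_right:
  fixes \<phi> :: "complex ^ 'm::finite \<Rightarrow> complex ^ 'n::finite"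
  assumes g: "g \<in> holomorphic_functions"
    and \<phi>: "\<And>k. (\<lambda>x. \<phi> x $ k) \<in> holomorphic_functions"
  shows "log_canonical_bracket c f (g \<circ> \<phi>) x =
    (\<Sum>k\<in>UNIV. partial_deriv k g (\<phi> x) * log_canonical_bracket c f (\<lambda>x. \<phi> x $ k) x)"
proof -
  have "log_deriv j (g \<circ> \<phi>) x =
      (\<Sum>k\<in>UNIV. partial_deriv k g (\<phi> x) * log_deriv j (\<lambda>x. \<phi> x $ k) x)" for j
    by (simp add: log_deriv_def partial_deriv_compose[OF g \<phi>] sum_distrib_left mult_ac)
  then show ?thesis
    unfolding log_canonical_bracket_Hamiltonian sum_distrib_left
    by (subst sum.swap) (simp add: mult_ac sum_distrib_left)
qed

text \<open>
  A bracket is determined by the brackets of the coordinates, by the chain rule.  Hence a map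
  intertwines two log-canonical brackets up to the factor \<open>s\<close> as soon as its components do so.
\<close>

lemma log_canonical_bracket_compose:
  fixes \<phi> :: "complex ^ 'm::finite \<Rightarrow> complex ^ 'n::finite"
  assumes skew: "\<And>i j. c $ j $ i = - (c $ i $ j)" "\<And>i j. d $ j $ i = - (d $ i $ j)"
    and f: "f \<in> holomorphic_functions" and g: "g \<in> holomorphic_functions"
    and \<phi>: "\<And>k. (\<lambda>x. \<phi> x $ k) \<in> holomorphic_functions"
    and components: "\<And>k l. log_canonical_bracket c (\<lambda>x. \<phi> x $ k) (\<lambda>x. \<phi> x $ l) x =
      s * (d $ k $ l * \<phi> x $ k * \<phi> x $ l)"
  shows "log_canonical_bracket c (f \<circ> \<phi>) (g \<circ> \<phi>) x = s * log_canonical_bracket d f g (\<phi> x)"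
proof -
  have "log_canonical_bracket c (f \<circ> \<phi>) (\<lambda>x. \<phi> x $ l) x =
      - (\<Sum>k\<in>UNIV. partial_deriv k f (\<phi> x) * (s * (d $ l $ k * \<phi> x $ l * \<phi> x $ k)))" for l
    by (subst log_canonical_bracket_skew[OF skew(1)])
      (simp add: log_canonical_bracket_compose_right[OF f \<phi>] components)
  then have "log_canonical_bracket c (f \<circ> \<phi>) (g \<circ> \<phi>) x = - (s * log_canonical_bracket d g f (\<phi> x))"
    unfolding log_canonical_bracket_compose_right[OF g \<phi>] log_canonical_bracket_def[of d] log_deriv_def
    by (simp add: sum_distrib_left sum_negf mult_ac)
  then show ?thesis
    using log_canonical_bracket_skew[where f = f and g = g and x = "\<phi> x", OF skew(2)] by simp
qed

section \<open>Signs in the exterior algebra\<close>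

text \<open>
  In the sum that defines the coefficient at \<open>K\<close> only the splitting of \<open>K\<close> into \<open>I\<close> and \<open>J\<close>
  contributes.
\<close>

lemma axis_wedge_axis:
  fixes I J :: "'n::{finite,linorder} set"
  shows "axis I 1 \<and>\<^sub>w axis J 1 = (if I \<inter> J = {} then wedge_sign I J *s axis (I \<union> J) 1 else 0)"
proof -
  have "(axis I 1 \<and>\<^sub>w axis J 1) $ K = (if I \<subseteq> K \<and> K - I = J then wedge_sign I J else 0)" for K
  proof -
    have "(axis I 1 \<and>\<^sub>w axis J 1) $ K =
        (\<Sum>I'\<in>Pow K. if I' = I then (if K - I = J then wedge_sign I J else 0) else 0)"
      unfolding wedge_def vec_lambda_beta by (intro sum.cong) (auto simp: axis_def)
    then show ?thesis
      by simp
  qed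
  moreover have "I \<subseteq> K \<and> K - I = J \<longleftrightarrow> I \<inter> J = {} \<and> K = I \<union> J" for K
    by auto
  ultimately show ?thesis
    by (simp add: vec_eq_iff axis_def)
qed

lemma wedge_add_left: "(\<alpha> + \<beta>) \<and>\<^sub>w \<gamma> = \<alpha> \<and>\<^sub>w \<gamma> + \<beta> \<and>\<^sub>w \<gamma>"
  and wedge_diff_left: "(\<alpha> - \<beta>) \<and>\<^sub>w \<gamma> = \<alpha> \<and>\<^sub>w \<gamma> - \<beta> \<and>\<^sub>w \<gamma>"
  and wedge_add_right: "\<gamma> \<and>\<^sub>w (\<alpha> + \<beta>) = \<gamma> \<and>\<^sub>w \<alpha> + \<gamma> \<and>\<^sub>w \<beta>"
  and wedge_scale_left: "(c *s \<alpha>) \<and>\<^sub>w \<gamma> = c *s (\<alpha> \<and>\<^sub>w \<gamma>)"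
  and wedge_scale_right: "\<gamma> \<and>\<^sub>w (c *s \<alpha>) = c *s (\<gamma> \<and>\<^sub>w \<alpha>)"
  by (simp_all add: wedge_def vec_eq_iff algebra_simps sum.distrib sum_subtractf sum_distrib_left)

lemma wedge_zero_left [simp]: "0 \<and>\<^sub>w \<gamma> = 0"
  and wedge_zero_right [simp]: "\<gamma> \<and>\<^sub>w 0 = 0"
  by (simp_all add: wedge_def vec_eq_iff)

lemma wedge_sum_left: "(\<Sum>i\<in>S. \<alpha> i) \<and>\<^sub>w \<gamma> = (\<Sum>i\<in>S. \<alpha> i \<and>\<^sub>w \<gamma>)"
  by (induction S rule: infinite_finite_induct) (simp_all add: wedge_add_left)

lemma wedge_sum_right: "\<gamma> \<and>\<^sub>w (\<Sum>i\<in>S. \<alpha> i) = (\<Sum>i\<in>S. \<gamma> \<and>\<^sub>w \<alpha> i)"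
  by (induction S rule: infinite_finite_induct) (simp_all add: wedge_add_right)

text \<open>
  The sign of the permutation that sorts a list without repetitions: the exponents add up to the
  number of inversions.
\<close>

primrec inversion_sign :: "'n::linorder list \<Rightarrow> complex" where
  "inversion_sign [] = 1"
| "inversion_sign (i # is) = (- 1) ^ length (filter (\<lambda>j. j < i) is) * inversion_sign is"

lemma inversion_sign_snoc:
  "inversion_sign (is @ [i]) = inversion_sign is * (- 1) ^ length (filter (\<lambda>j. i < j) is)"
  by (induction "is") auto

lemma wedge_sign_singleton_left: "wedge_sign {i} J = (- 1) ^ card {j \<in> J. j < i}"
proof -
  have "{(k, j). k \<in> {i} \<and> j \<in> J \<and> j < k} = Pair i ` {j \<in> J. j < i}"
    by auto
  then show ?thesis
    by (simp add: wedge_sign_def card_image inj_on_def)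
qed

lemma wedge_sign_singleton_right: "wedge_sign I {j} = (- 1) ^ card {i \<in> I. j < i}"
proof -
  have "{(i, k). i \<in> I \<and> k \<in> {j} \<and> k < i} = (\<lambda>i. (i, j)) ` {i \<in> I. j < i}"
    by auto
  then show ?thesis
    by (simp add: wedge_sign_def card_image inj_on_def)
qed

lemma dxs_eq_inversion_sign:
  "dxs is = (if distinct is then inversion_sign is *s axis (set is) 1 else 0)"
proof (induction "is")
  case Nil
  then show ?case by (simp add: dxs_def)
next
  case (Cons i "is")
  have "dxs (i # is) = dx i \<and>\<^sub>w dxs is"
    by (simp add: dxs_def)
  moreover have "card {j \<in> set is. j < i} = length (filter (\<lambda>j. j < i) is)" if "distinct is"
    using that distinct_card[of "filter (\<lambda>j. j < i) is"] by simp
  ultimately show ?case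
    by (simp add: Cons.IH dx_def wedge_scale_right axis_wedge_axis wedge_sign_singleton_left mult.commute)
qed

lemma dxs_wedge_dx: "dxs is \<and>\<^sub>w dx i = dxs (is @ [i])"
proof -
  have "card {j \<in> set is. i < j} = length (filter (\<lambda>j. i < j) is)" if "distinct is"
    using that distinct_card[of "filter (\<lambda>j. i < j) is"] by simp
  then show ?thesis
    by (simp add: dxs_eq_inversion_sign dx_def wedge_scale_left axis_wedge_axis
        wedge_sign_singleton_right inversion_sign_snoc)
qed

section \<open>The bracket of Omega is log-canonical\<close>

lemma exhaust_6: "x = 1 \<or> x = 2 \<or> x = 3 \<or> x = 4 \<or> x = 5 \<or> x = 6" for x :: 6
proof (induct x)
  case (of_int z)
  then have "z = 0 \<or> z = 1 \<or> z = 2 \<or> z = 3 \<or> z = 4 \<or> z = 5"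
    by fastforce
  then show ?case
    by auto
qed

lemma forall_6: "(\<forall>i::6. P i) \<longleftrightarrow> P 1 \<and> P 2 \<and> P 3 \<and> P 4 \<and> P 5 \<and> P 6"
  by (metis exhaust_6)

lemma vector_6:
  "vector [a, b, c, d, e, f] $ (1::6) = a"
  "vector [a, b, c, d, e, f] $ (2::6) = b"
  "vector [a, b, c, d, e, f] $ (3::6) = c"
  "vector [a, b, c, d, e, f] $ (4::6) = d"
  "vector [a, b, c, d, e, f] $ (5::6) = e"
  "vector [a, b, c, d, e, f] $ (6::6) = f"
  by (simp_all add: vector_def)

lemma less_6:
  "1 < (2::6)" "1 < (3::6)" "1 < (4::6)" "1 < (5::6)" "~ 1 < (6::6)"
  "~ 2 < (1::6)" "2 < (3::6)" "2 < (4::6)" "2 < (5::6)" "~ 2 < (6::6)"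
  "~ 3 < (1::6)" "~ 3 < (2::6)" "3 < (4::6)" "3 < (5::6)" "~ 3 < (6::6)"
  "~ 4 < (1::6)" "~ 4 < (2::6)" "~ 4 < (3::6)" "4 < (5::6)" "~ 4 < (6::6)"
  "~ 5 < (1::6)" "~ 5 < (2::6)" "~ 5 < (3::6)" "~ 5 < (4::6)" "~ 5 < (6::6)"
  "6 < (1::6)" "6 < (2::6)" "6 < (3::6)" "6 < (4::6)" "6 < (5::6)"
  by (simp_all add: less_bit0_def bit0.Rep_numeral bit0.Rep_1)

text \<open>
  The minus sign comes from \<open>dV\<close>: the index \<open>6 = 0\<close> of its last factor is the smallest one, so this
  factor has to pass the five others.
\<close>

lemma dxs_eq_dV:
  fixes "is" :: "6 list"
  assumes "length is = 6"
  shows "dxs is = (if distinct is then - inversion_sign is else 0) *s dV"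
proof -
  have "set js = UNIV" if "distinct js" "length js = 6" for js :: "6 list"
    using that by (intro card_subset_eq) (auto simp: distinct_card)
  moreover have "dV = (- 1) *s axis UNIV 1"
    using calculation[of "[1, 2, 3, 4, 5, 6]"]
    by (simp add: dV_def dxs_eq_inversion_sign less_6)
  ultimately show ?thesis
    using assms by (simp add: dxs_eq_inversion_sign vec_eq_iff)
qed

text \<open>
  Group the coordinates into the pairs \<open>(x_1, x_2)\<close>, \<open>(x_3, x_4)\<close>, \<open>(x_5, x_6)\<close> and give the members
  of each pair the signs \<open>+1\<close> and \<open>-1\<close>.  The entry at \<open>(i, j)\<close> is the product of the signs of \<open>i\<close> and
  \<open>j\<close>, times \<open>-1\<close> if the pair of \<open>j\<close> follows the pair of \<open>i\<close> in the cyclic order of the three pairs,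
  times \<open>+1\<close> if it precedes it, and times \<open>0\<close> if the pairs coincide.
\<close>

definition omega_matrix :: "complex ^ 6 ^ 6" where
  "omega_matrix = vector
    [vector [ 0,  0, -1,  1,  1, -1],
     vector [ 0,  0,  1, -1, -1,  1],
     vector [ 1, -1,  0,  0, -1,  1],
     vector [-1,  1,  0,  0,  1, -1],
     vector [-1,  1,  1, -1,  0,  0],
     vector [ 1, -1, -1,  1,  0,  0]]"

text \<open>
  If \<open>p\<close> and \<open>q\<close> are the two indices missing from \<open>is\<close>, the wedge product is nonzero only if
  \<open>{i, j} = {p, q}\<close>, and exchanging the last two factors changes its sign.
\<close>

lemma dxs_wedge_dx_dx:
  fixes p q i j :: 6
  assumes "distinct (is @ [p, q])" "length is = 4"
  shows "dxs is \<and>\<^sub>w dx i \<and>\<^sub>w dx j =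
    (- inversion_sign (is @ [p, q]) *
      (if i = p \<and> j = q then 1 else if i = q \<and> j = p then - 1 else 0)) *s dV"
proof -
  have "set (is @ [p, q]) = UNIV"
    using assms by (intro card_subset_eq) (auto simp: distinct_card)
  then have "k \<notin> set is \<longleftrightarrow> k = p \<or> k = q" for k
    using assms by auto
  then have "distinct (is @ [i, j]) \<longleftrightarrow> (i = p \<and> j = q) \<or> (i = q \<and> j = p)"
    using assms by auto
  moreover have "inversion_sign (is @ [q, p]) = - inversion_sign (is @ [p, q])"
    using assms inversion_sign_snoc[of "is @ [p]" q] inversion_sign_snoc[of "is @ [q]" p]
      inversion_sign_snoc[of "is" q] inversion_sign_snoc[of "is" p]
    by (cases p q rule: linorder_cases) auto
  ultimately show ?thesis
    using assms by (auto simp: dxs_wedge_dx dxs_eq_dV)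
qed

lemma Omega_wedge_dx_dx:
  "Omega x \<and>\<^sub>w dx i \<and>\<^sub>w dx j = (omega_matrix $ i $ j * (x $ i * x $ j)) *s dV"
proof -
  define \<delta> :: "6 \<Rightarrow> 6 \<Rightarrow> complex" where
    "\<delta> p q = (if i = p \<and> j = q then 1 else if i = q \<and> j = p then - 1 else 0)" for p q
  have monomials:
    "dxs [2,4,5,6] \<and>\<^sub>w dx i \<and>\<^sub>w dx j = - \<delta> 1 3 *s dV"
    "dxs [2,3,5,6] \<and>\<^sub>w dx i \<and>\<^sub>w dx j = \<delta> 1 4 *s dV"
    "dxs [2,3,4,6] \<and>\<^sub>w dx i \<and>\<^sub>w dx j = - \<delta> 1 5 *s dV"
    "dxs [2,3,4,5] \<and>\<^sub>w dx i \<and>\<^sub>w dx j = \<delta> 1 6 *s dV"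
    "dxs [1,4,5,6] \<and>\<^sub>w dx i \<and>\<^sub>w dx j = \<delta> 2 3 *s dV"
    "dxs [1,3,5,6] \<and>\<^sub>w dx i \<and>\<^sub>w dx j = - \<delta> 2 4 *s dV"
    "dxs [1,3,4,6] \<and>\<^sub>w dx i \<and>\<^sub>w dx j = \<delta> 2 5 *s dV"
    "dxs [1,3,4,5] \<and>\<^sub>w dx i \<and>\<^sub>w dx j = - \<delta> 2 6 *s dV"
    "dxs [1,2,4,6] \<and>\<^sub>w dx i \<and>\<^sub>w dx j = - \<delta> 3 5 *s dV"
    "dxs [1,2,4,5] \<and>\<^sub>w dx i \<and>\<^sub>w dx j = \<delta> 3 6 *s dV"
    "dxs [1,2,3,6] \<and>\<^sub>w dx i \<and>\<^sub>w dx j = \<delta> 4 5 *s dV"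
    "dxs [1,2,3,5] \<and>\<^sub>w dx i \<and>\<^sub>w dx j = - \<delta> 4 6 *s dV"
    subgoal using dxs_wedge_dx_dx[of "[2,4,5,6]" 1 3 i j, folded \<delta>_def] by (simp add: less_6)
    subgoal using dxs_wedge_dx_dx[of "[2,3,5,6]" 1 4 i j, folded \<delta>_def] by (simp add: less_6)
    subgoal using dxs_wedge_dx_dx[of "[2,3,4,6]" 1 5 i j, folded \<delta>_def] by (simp add: less_6)
    subgoal using dxs_wedge_dx_dx[of "[2,3,4,5]" 1 6 i j, folded \<delta>_def] by (simp add: less_6)
    subgoal using dxs_wedge_dx_dx[of "[1,4,5,6]" 2 3 i j, folded \<delta>_def] by (simp add: less_6)
    subgoal using dxs_wedge_dx_dx[of "[1,3,5,6]" 2 4 i j, folded \<delta>_def] by (simp add: less_6)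
    subgoal using dxs_wedge_dx_dx[of "[1,3,4,6]" 2 5 i j, folded \<delta>_def] by (simp add: less_6)
    subgoal using dxs_wedge_dx_dx[of "[1,3,4,5]" 2 6 i j, folded \<delta>_def] by (simp add: less_6)
    subgoal using dxs_wedge_dx_dx[of "[1,2,4,6]" 3 5 i j, folded \<delta>_def] by (simp add: less_6)
    subgoal using dxs_wedge_dx_dx[of "[1,2,4,5]" 3 6 i j, folded \<delta>_def] by (simp add: less_6)
    subgoal using dxs_wedge_dx_dx[of "[1,2,3,6]" 4 5 i j, folded \<delta>_def] by (simp add: less_6)
    subgoal using dxs_wedge_dx_dx[of "[1,2,3,5]" 4 6 i j, folded \<delta>_def] by (simp add: less_6)
    done
  have "Omega x \<and>\<^sub>w dx i \<and>\<^sub>w dx j =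
     (- x$1 * x$3 * \<delta> 1 3 + x$1 * x$4 * \<delta> 1 4 + x$1 * x$5 * \<delta> 1 5 - x$1 * x$6 * \<delta> 1 6
      + x$2 * x$3 * \<delta> 2 3 - x$2 * x$4 * \<delta> 2 4 - x$2 * x$5 * \<delta> 2 5 + x$2 * x$6 * \<delta> 2 6
      - x$3 * x$5 * \<delta> 3 5 + x$3 * x$6 * \<delta> 3 6 + x$4 * x$5 * \<delta> 4 5 - x$4 * x$6 * \<delta> 4 6) *s dV"
    unfolding Omega_def wedge_add_left wedge_diff_left wedge_scale_left monomials
    by (simp add: vec_eq_iff algebra_simps)
  also have "\<dots> = (omega_matrix $ i $ j * (x $ i * x $ j)) *s dV"
    using exhaust_6[of i] exhaust_6[of j]
    by (elim disjE; simp add: \<delta>_def omega_matrix_def vector_6)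
  finally show ?thesis .
qed

lemma over_dV_scale: "over_dV (c *s dV) = c"
proof -
  have "dV \<noteq> 0"
    by (simp add: dV_def dxs_eq_inversion_sign less_6 vec_eq_iff axis_def)
  then show ?thesis
    unfolding over_dV_def by (intro the_equality) (simp_all add: vec_eq_iff, metis)
qed

lemma Omega_bracket_eq:
  "Omega_bracket f g x = (\<Sum>i\<in>UNIV. \<Sum>j\<in>UNIV.
    omega_matrix $ i $ j * (x $ i * partial_deriv i f x) * (x $ j * partial_deriv j g x))"
proof -
  have sum_scale: "(\<Sum>i\<in>S. c i *s dV) = (\<Sum>i\<in>S. c i) *s dV" for S and c :: "6 \<Rightarrow> complex"
    by (simp add: vec_eq_iff sum_distrib_right)
  show ?thesis
    unfolding Omega_bracket_def differential_def wedge_sum_left wedge_sum_right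
      wedge_scale_left wedge_scale_right Omega_wedge_dx_dx
      vector_smult_assoc sum_scale over_dV_scale
    by (subst sum.swap) (simp add: sum_distrib_left mult_ac)
qed

lemma Omega_bracket_log_canonical: "Omega_bracket = log_canonical_bracket omega_matrix"
  by (simp add: fun_eq_iff Omega_bracket_eq log_canonical_bracket_def log_deriv_def)

lemma omega_matrix_skew: "omega_matrix $ j $ i = - (omega_matrix $ i $ j)"
proof -
  have "\<forall>i j. omega_matrix $ j $ i = - (omega_matrix $ i $ j)"
    unfolding forall_6 by (simp add: omega_matrix_def vector_6)
  then show ?thesis
    by blast
qed

section \<open>The symmetries\<close>

text \<open>
  On coordinates everything reduces to \<open>omega_matrix\<close>.  The map \<open>nu\<close> flips the signs of all
  coordinates, so the products of two signs stay the same; \<open>sigma1\<close> and \<open>sigma2\<close> keep the signs and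
  exchange two of the three pairs, which reverses the cyclic order.  Any rescaling of coordinates
  preserves a log-canonical bracket, in particular \<open>lam i j\<close>.

  The bracket of two monomials is a constant multiple of their product.  For \<open>tau1\<close>, the monomials
  \<open>x_4\<close> and \<open>x_1 x_5\<close> of the fifth component give the same constant when paired with any of \<open>x_1\<close>,
  \<open>x_2\<close>, \<open>x_5\<close>, \<open>x_6\<close>, and so do the monomials \<open>x_3\<close> and \<open>x_2 x_6\<close> of the sixth component; moreover, both
  monomials of the fifth component commute with both of the sixth.  The components thus satisfy the
  same log-canonical relations as those of \<open>(-x_2, -x_1, x_6, x_5, x_4, x_3)\<close>, a map that flips all
  signs and exchanges two pairs.  The same reasoning applies to \<open>tau2\<close>, with \<open>x_2 - x_3 x_5\<close> and
  \<open>x_1 - x_4 x_6\<close> in place of the fifth and sixth component.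
\<close>

lemma Omega_bracket_compose:
  assumes f: "f \<in> holomorphic_functions" and g: "g \<in> holomorphic_functions"
    and \<phi>: "\<forall>k. (\<lambda>x. \<phi> x $ k) \<in> holomorphic_functions"
    and components: "\<forall>k l. Omega_bracket (\<lambda>x. \<phi> x $ k) (\<lambda>x. \<phi> x $ l) x =
      s * (omega_matrix $ k $ l * \<phi> x $ k * \<phi> x $ l)"
  shows "Omega_bracket (f \<circ> \<phi>) (g \<circ> \<phi>) x = s * Omega_bracket f g (\<phi> x)"
  using \<phi> components unfolding Omega_bracket_log_canonical
  by (intro log_canonical_bracket_compose omega_matrix_skew f g) auto

lemma invariant_under_OmegaI:
  assumes "bij \<phi>" "A \<subseteq> holomorphic_functions"
    and "\<forall>k. (\<lambda>x. \<phi> x $ k) \<in> holomorphic_functions"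
    and "\<And>x. \<forall>k l. Omega_bracket (\<lambda>x. \<phi> x $ k) (\<lambda>x. \<phi> x $ l) x =
      1 * (omega_matrix $ k $ l * \<phi> x $ k * \<phi> x $ l)"
  shows "invariant_under A Omega_bracket \<phi>"
  unfolding invariant_under_def
  using assms(1,2) Omega_bracket_compose[OF _ _ assms(3,4)] by (simp add: subset_iff)

lemma anti_invariant_under_OmegaI:
  assumes "bij \<phi>" "A \<subseteq> holomorphic_functions"
    and "\<forall>k. (\<lambda>x. \<phi> x $ k) \<in> holomorphic_functions"
    and "\<And>x. \<forall>k l. Omega_bracket (\<lambda>x. \<phi> x $ k) (\<lambda>x. \<phi> x $ l) x =
      - 1 * (omega_matrix $ k $ l * \<phi> x $ k * \<phi> x $ l)"
  shows "anti_invariant_under A Omega_bracket \<phi>"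
  unfolding anti_invariant_under_def
  using assms(1,2) Omega_bracket_compose[OF _ _ assms(3,4)] by (simp add: subset_iff)

lemmas holomorphic_functions_intros = holomorphic_functions_coord holomorphic_functions_const
  holomorphic_functions_add holomorphic_functions_mult holomorphic_functions_diff
  holomorphic_functions_minus

lemmas log_canonical_bracket_simps =
  log_canonical_bracket_coord log_canonical_bracket_const log_canonical_bracket_minus
  log_canonical_bracket_diff_left log_canonical_bracket_diff_right
  log_canonical_bracket_Leibniz_left log_canonical_bracket_Leibniz_right

lemma invariant_under_lam:
  assumes "A \<subseteq> holomorphic_functions"
  shows "invariant_under A Omega_bracket (lam i j)"
proof (rule invariant_under_OmegaI[OF _ assms])
  show "bij (lam i j)"
    by (rule involuntory_imp_bij) (simp add: vec_eq_iff forall_6 lam_def vector_6)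
  show "\<forall>k. (\<lambda>x. lam i j x $ k) \<in> holomorphic_functions"
    unfolding forall_6 lam_def vector_6 by (intro conjI holomorphic_functions_intros)
  show "\<forall>k l. Omega_bracket (\<lambda>x. lam i j x $ k) (\<lambda>x. lam i j x $ l) x =
      1 * (omega_matrix $ k $ l * lam i j x $ k * lam i j x $ l)" for x
    unfolding forall_6 lam_def vector_6 Omega_bracket_log_canonical
    by (simp add: log_canonical_bracket_simps holomorphic_functions_intros omega_matrix_def vector_6
        algebra_simps)
qed

lemma invariant_under_nu:
  assumes "A \<subseteq> holomorphic_functions"
  shows "invariant_under A Omega_bracket nu"
proof (rule invariant_under_OmegaI[OF _ assms])
  show "bij nu"
    by (rule involuntory_imp_bij) (simp add: vec_eq_iff forall_6 nu_def vector_6)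
  show "\<forall>k. (\<lambda>x. nu x $ k) \<in> holomorphic_functions"
    unfolding forall_6 nu_def vector_6 by (intro conjI holomorphic_functions_intros)
  show "\<forall>k l. Omega_bracket (\<lambda>x. nu x $ k) (\<lambda>x. nu x $ l) x =
      1 * (omega_matrix $ k $ l * nu x $ k * nu x $ l)" for x
    unfolding forall_6 nu_def vector_6 Omega_bracket_log_canonical
    by (simp add: log_canonical_bracket_simps holomorphic_functions_intros omega_matrix_def vector_6
        algebra_simps)
qed

lemma anti_invariant_under_sigma1:
  assumes "A \<subseteq> holomorphic_functions"
  shows "anti_invariant_under A Omega_bracket sigma1"
proof (rule anti_invariant_under_OmegaI[OF _ assms])
  show "bij sigma1"
    by (rule involuntory_imp_bij) (simp add: vec_eq_iff forall_6 sigma1_def vector_6)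
  show "\<forall>k. (\<lambda>x. sigma1 x $ k) \<in> holomorphic_functions"
    unfolding forall_6 sigma1_def vector_6 by (intro conjI holomorphic_functions_intros)
  show "\<forall>k l. Omega_bracket (\<lambda>x. sigma1 x $ k) (\<lambda>x. sigma1 x $ l) x =
      - 1 * (omega_matrix $ k $ l * sigma1 x $ k * sigma1 x $ l)" for x
    unfolding forall_6 sigma1_def vector_6 Omega_bracket_log_canonical
    by (simp add: log_canonical_bracket_simps holomorphic_functions_intros omega_matrix_def vector_6
        algebra_simps)
qed

lemma anti_invariant_under_sigma2:
  assumes "A \<subseteq> holomorphic_functions"
  shows "anti_invariant_under A Omega_bracket sigma2"
proof (rule anti_invariant_under_OmegaI[OF _ assms])
  show "bij sigma2"
    by (rule involuntory_imp_bij) (simp add: vec_eq_iff forall_6 sigma2_def vector_6)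
  show "\<forall>k. (\<lambda>x. sigma2 x $ k) \<in> holomorphic_functions"
    unfolding forall_6 sigma2_def vector_6 by (intro conjI holomorphic_functions_intros)
  show "\<forall>k l. Omega_bracket (\<lambda>x. sigma2 x $ k) (\<lambda>x. sigma2 x $ l) x =
      - 1 * (omega_matrix $ k $ l * sigma2 x $ k * sigma2 x $ l)" for x
    unfolding forall_6 sigma2_def vector_6 Omega_bracket_log_canonical
    by (simp add: log_canonical_bracket_simps holomorphic_functions_intros omega_matrix_def vector_6
        algebra_simps)
qed

lemma anti_invariant_under_tau1:
  assumes "A \<subseteq> holomorphic_functions"
  shows "anti_invariant_under A Omega_bracket tau1"
proof (rule anti_invariant_under_OmegaI[OF _ assms])
  show "bij tau1"
  proof (rule o_bij)
    define \<psi> :: "complex ^ 6 \<Rightarrow> complex ^ 6" where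
      "\<psi> y = vector [- y$2, - y$1, y$6 - y$1 * y$3, y$5 - y$2 * y$4, y$4, y$3]" for y
    show "\<psi> \<circ> tau1 = id" "tau1 \<circ> \<psi> = id"
      by (simp_all add: fun_eq_iff vec_eq_iff forall_6 \<psi>_def tau1_def vector_6)
  qed
  show "\<forall>k. (\<lambda>x. tau1 x $ k) \<in> holomorphic_functions"
    unfolding forall_6 tau1_def vector_6 by (intro conjI holomorphic_functions_intros)
  show "\<forall>k l. Omega_bracket (\<lambda>x. tau1 x $ k) (\<lambda>x. tau1 x $ l) x =
      - 1 * (omega_matrix $ k $ l * tau1 x $ k * tau1 x $ l)" for x
    unfolding forall_6 tau1_def vector_6 Omega_bracket_log_canonical
    by (simp add: log_canonical_bracket_simps holomorphic_functions_intros omega_matrix_def vector_6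
        algebra_simps)
qed

lemma anti_invariant_under_tau2:
  assumes "A \<subseteq> holomorphic_functions"
  shows "anti_invariant_under A Omega_bracket tau2"
proof (rule anti_invariant_under_OmegaI[OF _ assms])
  show "bij tau2"
  proof (rule o_bij)
    define \<psi> :: "complex ^ 6 \<Rightarrow> complex ^ 6" where
      "\<psi> y = vector [y$4 - y$1 * y$5, y$3 - y$2 * y$6, y$2, y$1, - y$6, - y$5]" for y
    show "\<psi> \<circ> tau2 = id" "tau2 \<circ> \<psi> = id"
      by (simp_all add: fun_eq_iff vec_eq_iff forall_6 \<psi>_def tau2_def vector_6)
  qed
  show "\<forall>k. (\<lambda>x. tau2 x $ k) \<in> holomorphic_functions"
    unfolding forall_6 tau2_def vector_6 by (intro conjI holomorphic_functions_intros)
  show "\<forall>k l. Omega_bracket (\<lambda>x. tau2 x $ k) (\<lambda>x. tau2 x $ l) x =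
      - 1 * (omega_matrix $ k $ l * tau2 x $ k * tau2 x $ l)" for x
    unfolding forall_6 tau2_def vector_6 Omega_bracket_log_canonical
    by (simp add: log_canonical_bracket_simps holomorphic_functions_intros omega_matrix_def vector_6
        algebra_simps)
qed

theorem theorem11p7:
  fixes A :: "(complex ^ 6 \<Rightarrow> complex) set"
  assumes "A = holomorphic_functions \<or> A = polynomial_functions"
  shows "poisson_structure_on A Omega_bracket
    \<and> (\<forall>i j. invariant_under A Omega_bracket (lam i j))
    \<and> invariant_under A Omega_bracket nu
    \<and> anti_invariant_under A Omega_bracket tau1
    \<and> anti_invariant_under A Omega_bracket tau2
    \<and> anti_invariant_under A Omega_bracket sigma1
    \<and> anti_invariant_under A Omega_bracket sigma2"
proof -
  have hol: "A \<subseteq> holomorphic_functions"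
    using assms polynomial_functions_subset_holomorphic by auto
  from assms have "poisson_structure_on A Omega_bracket"
    unfolding Omega_bracket_log_canonical
  proof
    assume "A = holomorphic_functions"
    then show "poisson_structure_on A (log_canonical_bracket omega_matrix)"
      by (intro poisson_structure_on_log_canonical_bracket omega_matrix_skew hol)
        (auto intro: holomorphic_functions_intros partial_deriv_holomorphic)
  next
    assume "A = polynomial_functions"
    then show "poisson_structure_on A (log_canonical_bracket omega_matrix)"
      by (intro poisson_structure_on_log_canonical_bracket omega_matrix_skew hol)
        (auto intro: polynomial_functions.intros partial_deriv_polynomial)
  qed
  then show ?thesis
    using hol
    by (simp add: invariant_under_lam invariant_under_nu anti_invariant_under_tau1
        anti_invariant_under_tau2 anti_invariant_under_sigma1 anti_invariant_under_sigma2)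
qed

end
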